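(* Every finite $3$-generator $E$-group is nilpotent of class at most $2$.
   Context: A group $G$ is called an $E$-group if every element of $G$ commutes with each of its endomorphic images, i.e. $x\,x^{\alpha}=x^{\alpha}x$ for every $x\in G$ and every endomorphism $\alpha$ of $G$. A $3$-generator group is a group that can be generated by three elements. *)

theory Defs
  imports "HOL-Algebra.Generated_Groups"
begin

definition E_group :: "('a, 'b) monoid_scheme \<Rightarrow> bool" where
  "E_group G \<longleftrightarrow> group G \<and>
     (\<forall>\<alpha> \<in> hom G G. \<forall>x \<in> carrier G. x \<otimes>\<^bsub>G\<^esub> \<alpha> x = \<alpha> x \<otimes>\<^bsub>G\<^esub> x)"

(* The generators need not be distinct, so a 2-generator group is also a 3-generator group. *)
definition three_generator :: "('a, 'b) monoid_scheme \<Rightarrow> bool" where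
  "three_generator G \<longleftrightarrow>
     (\<exists>a \<in> carrier G. \<exists>b \<in> carrier G. \<exists>c \<in> carrier G. generate G {a, b, c} = carrier G)"

(* Same convention for commutators as in derived_set. *)
definition commutator :: "('a, 'b) monoid_scheme \<Rightarrow> 'a \<Rightarrow> 'a \<Rightarrow> 'a" where
  "commutator G x y = x \<otimes>\<^bsub>G\<^esub> y \<otimes>\<^bsub>G\<^esub> inv\<^bsub>G\<^esub> x \<otimes>\<^bsub>G\<^esub> inv\<^bsub>G\<^esub> y"

(* Indexed from 0: the n-th term is usually written gamma_(n+1)(G), with gamma_1(G) = G. *)
primrec lower_central :: "('a, 'b) monoid_scheme \<Rightarrow> nat \<Rightarrow> 'a set" where
  "lower_central G 0 = carrier G"
| "lower_central G (Suc n) =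
     generate G {commutator G x y | x y. x \<in> lower_central G n \<and> y \<in> carrier G}"

definition nilpotent :: "('a, 'b) monoid_scheme \<Rightarrow> bool" where
  "nilpotent G \<longleftrightarrow> (\<exists>n. lower_central G n = {\<one>\<^bsub>G\<^esub>})"

(* Meaningful only for nilpotent G; the trivial group has class 0. *)
definition nilpotency_class :: "('a, 'b) monoid_scheme \<Rightarrow> nat" where
  "nilpotency_class G = (LEAST n. lower_central G n = {\<one>\<^bsub>G\<^esub>})"

lemma lower_central_1: "lower_central G 1 = derived G (carrier G)"
proof -
  have "{commutator G x y | x y. x \<in> carrier G \<and> y \<in> carrier G} = derived_set G (carrier G)"
    by (auto simp: commutator_def)
  then show ?thesis by (simp add: derived_def)
qed

end

theory Submission
  imports Defs "HOL-Algebra.Multiplicative_Group" "HOL-Computational_Algebra.Primes"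
begin

text \<open>
  Inner automorphisms are endomorphisms, so an E-group is 2-Engel. By Levi's theorem its triple
  commutators are then central, of order dividing 3, and the map sending \<open>x, y, z\<close> to
  \<open>[x, [y, z]]\<close> is multilinear and alternating; hence for \<open>G = \<langle>a, b, c\<rangle>\<close>
  they all lie in the group generated by \<open>t = [a, [b, c]]\<close>.

  Let \<open>n\<close> be the exponent of \<open>G / G'\<close>. This quotient has a cyclic direct factor of order
  \<open>n\<close>, so every \<open>y\<close> with \<open>y\<^sup>n = 1\<close> generates the image of an endomorphism, and the
  E-property forces \<open>y\<close> to be central. Put \<open>u = [a, b]\<close> and \<open>v = [a, c]\<close>. Since
  \<open>a\<^sup>n \<in> G'\<close>, both \<open>u\<^sup>n = [a\<^sup>n, b]\<close> and \<open>v\<^sup>n = [a\<^sup>n, c]\<close> are powers of \<open>t\<close>.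
  As \<open>t\<^sup>3 = 1\<close>, either \<open>u\<close> or some \<open>v u\<^sup>k\<close> has trivial \<open>n\<close>-th power and is therefore
  central; commuting it with \<open>c\<close>, respectively \<open>b\<close>, gives \<open>t = 1\<close>.
\<close>

subsection \<open>Exponents of finite abelian groups\<close>

context comm_group begin

text \<open>An element \<open>a\<close> of maximal order \<open>N\<close> works. If some prime power
  in \<open>ord x\<close> exceeded the one in \<open>N\<close>, exchanging the p-part of
  \<open>a\<close> for that of \<open>x\<close> would produce an element of larger order.\<close>

lemma exponent_attained:
  assumes fin: "finite (carrier G)"
  obtains a where "a \<in> carrier G" "\<And>x. x \<in> carrier G \<Longrightarrow> x [^] ord a = \<one>"
proof -
  define N where "N = Max (ord ` carrier G)"
  have "N \<in> ord ` carrier G"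
    unfolding N_def using fin by (intro Max_in) auto
  then obtain a where a: "a \<in> carrier G" "ord a = N" by auto
  have max: "ord y \<le> N" if "y \<in> carrier G" for y
    unfolding N_def using fin that by (intro Max_ge) auto
  have pos: "ord y > 0" if "y \<in> carrier G" for y
    using ord_ge_1[OF fin that] by simp
  have "ord x dvd N" if x: "x \<in> carrier G" for x
  proof (rule multiplicity_le_imp_dvd)
    show "ord x \<noteq> 0" using pos[OF x] by simp
    fix p :: nat assume p: "prime p"
    define i where "i = multiplicity p N"
    define j where "j = multiplicity p (ord x)"
    obtain N' where N': "N = p ^ i * N'" "\<not> p dvd N'"
      using multiplicity_decompose'[of N p] p pos[OF a(1)] a(2) unfolding i_def
      by (metis not_gr0 not_prime_unit)
    obtain r where r: "ord x = p ^ j * r"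
      unfolding j_def by (metis dvd_def multiplicity_dvd)
    define a' where "a' = a [^] (p ^ i)"
    define x' where "x' = x [^] r"
    have p0: "p > 0" using p by (simp add: prime_gt_0_nat)
    have r0: "r > 0" using r pos[OF x] by (cases r) auto
    have a': "a' \<in> carrier G" "ord a' = N'"
      unfolding a'_def using a N' p0 by (auto simp: ord_pow)
    have x': "x' \<in> carrier G" "ord x' = p ^ j"
      unfolding x'_def using x r r0 by (auto simp: ord_pow)
    have cop: "coprime (p ^ j) N'"
      using N'(2) p by (simp add: prime_imp_coprime)
    have "N' * p ^ j dvd ord (a' \<otimes> x')"
    proof -
      define l where "l = ord (a' \<otimes> x')"
      have l: "a' [^] l \<otimes> x' [^] l = \<one>"
        unfolding l_def using a' x' by (simp flip: nat_pow_distrib)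
      \<comment> \<open>Raising the relation \<open>l\<close> to the power \<open>p ^ j\<close>
        removes \<open>x'\<close>, and to the power \<open>N'\<close> removes \<open>a'\<close>;
        coprimality then lets both orders divide the number \<open>l\<close>.\<close>
      have "a' [^] (l * p ^ j) = (a' [^] l \<otimes> x' [^] l) [^] (p ^ j)"
        using a' x' pow_eq_id[OF x'(1), of "l * p ^ j"]
        by (simp add: nat_pow_distrib nat_pow_pow)
      then have "N' dvd l * p ^ j" using l a' pow_eq_id by fastforce
      then have 1: "N' dvd l" using cop by (metis coprime_commute coprime_dvd_mult_left_iff)
      have "x' [^] (l * N') = (a' [^] l \<otimes> x' [^] l) [^] N'"
        using a' x' pow_eq_id[OF a'(1), of "l * N'"]
        by (simp add: nat_pow_distrib nat_pow_pow)
      then have "p ^ j dvd l * N'" using l x' pow_eq_id by fastforce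
      then have 2: "p ^ j dvd l" using cop by (metis coprime_dvd_mult_left_iff)
      show ?thesis using 1 2 cop unfolding l_def
        by (simp add: coprime_commute divides_mult)
    qed
    then have "N' * p ^ j \<le> N"
      using max[of "a' \<otimes> x'"] pos[of "a' \<otimes> x'"] a' x' by (meson dvd_imp_le le_trans m_closed)
    then have "p ^ j \<le> p ^ i"
      using N' pos[OF a(1)] a(2) by (simp add: mult.commute)
    then have "j \<le> i" using p prime_gt_1_nat by (meson power_le_imp_le_exp)
    then show "multiplicity p (ord x) \<le> multiplicity p N" unfolding i_def j_def .
  qed
  then show ?thesis using that[of a] a pow_eq_id by auto
qed

text \<open>Serves twice in the splitting below: for the product of the cyclic group of
  \<open>a\<close> with \<open>B\<close>, and for enlarging \<open>B\<close> by one element.\<close>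

lemma subgroup_int_pow_mult:
  assumes sB: "subgroup B G" and y: "y \<in> carrier G"
  shows "subgroup {y [^] k \<otimes> b | k b. k \<in> (UNIV::int set) \<and> b \<in> B} G" 
proof -
  define S where "S = {y [^] k \<otimes> b | k b. k \<in> (UNIV::int set) \<and> b \<in> B}"
  note Bc = subgroup.mem_carrier[OF sB]
  have SI: "y [^] (k::int) \<otimes> b \<in> S" if "b \<in> B" for k b
    using that unfolding S_def by blast
  have "subgroup S G"
  proof (rule subgroupI)
    show "S \<subseteq> carrier G" using y Bc unfolding S_def by auto
    show "S \<noteq> {}" using SI[OF subgroup.one_closed[OF sB]] by blast
    show "inv u \<in> S" if "u \<in> S" for u
    proof -
      obtain k b where u: "u = y [^] (k::int) \<otimes> b" "b \<in> B" using \<open>u \<in> S\<close> unfolding S_def by blast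
      have "inv u = inv (y [^] k) \<otimes> inv b"
        unfolding u(1) by (rule inv_mult) (use y u(2) Bc in auto)
      then have "inv u = y [^] (-k) \<otimes> inv b" by (simp only: int_pow_neg[OF y])
      then show ?thesis using SI[OF subgroup.m_inv_closed[OF sB u(2)]] by simp
    qed
    show "u \<otimes> v \<in> S" if "u \<in> S" "v \<in> S" for u v
    proof -
      obtain k b where u: "u = y [^] (k::int) \<otimes> b" "b \<in> B" using \<open>u \<in> S\<close> unfolding S_def by blast
      obtain l c where v: "v = y [^] (l::int) \<otimes> c" "c \<in> B" using \<open>v \<in> S\<close> unfolding S_def by blast
      have "u \<otimes> v = y [^] (k + l) \<otimes> (b \<otimes> c)"
        using y u v Bc by (simp add: int_pow_mult m_ac)
      then show ?thesis using SI[OF subgroup.m_closed[OF sB u(2) v(2)]] by simp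
    qed
  qed
  then show ?thesis unfolding S_def .
qed

text \<open>Take \<open>B\<close> maximal among the subgroups meeting the cyclic group of
  \<open>a\<close> trivially. Because \<open>ord a\<close> is an exponent, any \<open>x\<close> can
  be multiplied by a power of \<open>a\<close> so that adjoining the result \<open>y\<close> to
  \<open>B\<close> creates no new intersection; maximality then puts \<open>y\<close> into
  \<open>B\<close>.\<close>

lemma exponent_cyclic_complement:
  assumes fin: "finite (carrier G)" and a: "a \<in> carrier G"
    and exp: "\<And>x. x \<in> carrier G \<Longrightarrow> x [^] ord a = \<one>"
  obtains B where "subgroup B G" "\<And>k::int. a [^] k \<in> B \<Longrightarrow> a [^] k = \<one>"
    "\<And>x. x \<in> carrier G \<Longrightarrow> \<exists>k::int. \<exists>b\<in>B. x = a [^] k \<otimes> b"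
proof -
  define F where "F = {B. subgroup B G \<and> (\<forall>k::int. a [^] k \<in> B \<longrightarrow> a [^] k = \<one>)}"
  have "F \<subseteq> Pow (carrier G)"
    unfolding F_def by (blast dest: subgroup.subset)
  then have "finite F"
    using fin by (meson finite_Pow_iff finite_subset)
  moreover have "{\<one>} \<in> F" unfolding F_def by (auto simp: triv_subgroup)
  ultimately obtain B where B: "B \<in> F" "\<And>B'. B' \<in> F \<Longrightarrow> B \<subseteq> B' \<Longrightarrow> B = B'"
    using finite_has_maximal[of F] by blast
  have sB: "subgroup B G" and int: "\<And>k::int. a [^] k \<in> B \<Longrightarrow> a [^] k = \<one>"
    using B(1) unfolding F_def by auto
  note Bc = subgroup.mem_carrier[OF sB]
  define n where "n = ord a"
  have n: "n > 0" using ord_ge_1[OF fin a] unfolding n_def by simp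
  define AB where "AB = {a [^] k \<otimes> b | k b. k \<in> (UNIV::int set) \<and> b \<in> B}"
  have ABI: "a [^] (k::int) \<otimes> b \<in> AB" if "b \<in> B" for k b
    using that unfolding AB_def by blast
  have sAB: "subgroup AB G"
    unfolding AB_def by (rule subgroup_int_pow_mult[OF sB a])
  have "x \<in> AB" if x: "x \<in> carrier G" for x
  proof -
    have xn: "x [^] n \<in> AB" using exp[OF x] subgroup.one_closed[OF sAB] by (simp add: n_def)
    \<comment> \<open>This is the order of \<open>x\<close> modulo \<open>AB\<close>.\<close>
    define m where "m = (LEAST m::nat. m > 0 \<and> x [^] m \<in> AB)"
    have m: "m > 0" "x [^] m \<in> AB"
      using LeastI[of "\<lambda>m::nat. m > 0 \<and> x [^] m \<in> AB" n] xn n unfolding m_def by auto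
    have least: "m \<le> l" if "l > 0" "x [^] l \<in> AB" for l
      using Least_le[of "\<lambda>m::nat. m > 0 \<and> x [^] m \<in> AB" l] that unfolding m_def by auto
    have mdvd: "int m dvd k" if k: "x [^] (k::int) \<in> AB" for k
    proof -
      define s where "s = nat (k mod int m)"
      have s: "int s = k mod int m" using m(1) unfolding s_def by simp
      have "x [^] s = x [^] (k mod int m)" by (simp flip: s add: int_pow_int)
      also have "\<dots> = x [^] (k - int m * (k div int m))" by (simp add: minus_mult_div_eq_mod)
      also have "\<dots> = x [^] k \<otimes> inv ((x [^] m) [^] (k div int m))"
        using x by (simp add: int_pow_diff int_pow_pow flip: int_pow_int)
      also have "\<dots> \<in> AB"
        using k m(2) sAB by (meson subgroup.m_closed subgroup.m_inv_closed subgroup_int_pow_closed)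
      finally have "x [^] s \<in> AB" .
      moreover have "s < m" using s m(1) by (metis of_nat_less_iff pos_mod_bound of_nat_0_less_iff)
      ultimately have "s = 0" using least[of s] by auto
      then show ?thesis using s by (simp add: dvd_eq_mod_eq_0)
    qed
    have "int m dvd int n" using mdvd[of "int n"] xn by (simp add: int_pow_int)
    then obtain q where q: "n = m * q" by auto
    obtain j b where jb: "x [^] m = a [^] (j::int) \<otimes> b" "b \<in> B" using m(2) unfolding AB_def by blast
    \<comment> \<open>The power \<open>q = n / m\<close> of the equation \<open>jb(1)\<close> shows
      that \<open>a [^] (j * q)\<close> lies in \<open>B\<close>, hence is trivial. So
      \<open>m * q\<close> divides \<open>j * q\<close>, and \<open>m\<close> divides
      \<open>j\<close>.\<close>
    have "\<one> = (a [^] j \<otimes> b) [^] int q"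
      using exp[OF x] x q unfolding n_def[symmetric] jb(1)[symmetric]
      by (simp add: nat_pow_pow int_pow_int)
    also have "\<dots> = a [^] (j * int q) \<otimes> b [^] int q"
      using a Bc jb(2) by (simp add: int_pow_distrib int_pow_pow)
    finally have eq: "a [^] (j * int q) = inv (b [^] int q)"
      using a Bc jb(2) by (metis inv_equality int_pow_closed)
    then have "a [^] (j * int q) \<in> B"
      using jb(2) sB by (metis subgroup.m_inv_closed subgroup_int_pow_closed)
    then have "a [^] (j * int q) = \<one>" by (rule int)
    then have "int n dvd j * int q" using int_pow_eq_id[OF a] unfolding n_def by simp
    then have "int m dvd j" using q n by simp
    then obtain i where i: "j = int m * i" by auto
    \<comment> \<open>Since \<open>j = m * i\<close>, this correction removes the
      \<open>a\<close>-part of \<open>x [^] m\<close> and leaves \<open>y [^] m = b\<close> in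
      \<open>B\<close>.\<close>
    define y where "y = x \<otimes> inv (a [^] i)"
    have y: "y \<in> carrier G" using x a unfolding y_def by simp
    have xy: "x = a [^] i \<otimes> y" using x a unfolding y_def by (simp add: m_ac)
    have yk: "x [^] k = a [^] (i * k) \<otimes> y [^] k" for k :: int
      using a y unfolding xy by (simp add: int_pow_distrib int_pow_pow)
    have "a [^] j \<otimes> b = a [^] j \<otimes> y [^] int m"
      using yk[of "int m"] jb(1) unfolding i by (simp add: int_pow_int mult.commute)
    then have ym: "y [^] int m = b" using a y Bc[OF jb(2)] by simp
    define B' where "B' = {y [^] k \<otimes> c | k c. k \<in> (UNIV::int set) \<and> c \<in> B}"
    have B'I: "y [^] (k::int) \<otimes> c \<in> B'" if "c \<in> B" for k c
      using that unfolding B'_def by blast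
    have sB': "subgroup B' G"
      unfolding B'_def by (rule subgroup_int_pow_mult[OF sB y])
    have "B' \<in> F"
    proof -
      have "a [^] k = \<one>" if k: "a [^] k \<in> B'" for k :: int
      proof -
        \<comment> \<open>From \<open>a [^] k = y [^] l \<otimes> c\<close> it follows that
          \<open>x [^] l\<close> is in \<open>AB\<close>, so \<open>m\<close> divides
          \<open>l\<close>. Then \<open>y [^] l\<close> is a power of \<open>b\<close>, which puts
          \<open>a [^] k\<close> into \<open>B\<close>.\<close>
        obtain l c where lc: "a [^] k = y [^] (l::int) \<otimes> c" "c \<in> B" using k unfolding B'_def by blast
        have "y [^] l = a [^] k \<otimes> inv c" using lc a y Bc[OF lc(2)] by (simp add: m_assoc)
        then have "x [^] l = a [^] (i * l + k) \<otimes> inv c"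
          using a Bc[OF lc(2)] by (simp add: yk int_pow_mult m_assoc)
        then have "x [^] l \<in> AB" using ABI[OF subgroup.m_inv_closed[OF sB lc(2)]] by simp
        then obtain e where e: "l = int m * e" using mdvd by blast
        have "y [^] l = b [^] e" using ym y unfolding e by (simp flip: int_pow_pow)
        then have "y [^] l \<in> B" using jb(2) sB by (metis subgroup_int_pow_closed)
        then show ?thesis using subgroup.m_closed[OF sB] lc int[of k] by simp
      qed
      then show ?thesis using sB' unfolding F_def by auto
    qed
    moreover have "B \<subseteq> B'" using B'I[of _ 0] Bc by force
    ultimately have "B = B'" using B(2) by blast
    moreover have "y \<in> B'" using B'I[OF subgroup.one_closed[OF sB], of 1] y by simp
    ultimately show ?thesis using ABI[of y i] xy by simp
  qed
  then show ?thesis using that[OF sB int] unfolding AB_def by blast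
qed

end

section \<open>Centralizers, and endomorphisms with cyclic image\<close>

definition centralizer :: "('a, 'b) monoid_scheme \<Rightarrow> 'a set \<Rightarrow> 'a set" where
  "centralizer G S = {g \<in> carrier G. \<forall>s\<in>S. g \<otimes>\<^bsub>G\<^esub> s = s \<otimes>\<^bsub>G\<^esub> g}"

text \<open>Lets commutation with fixed elements pass to products, inverses and integer powers by
  the subgroup rules.\<close>

lemma (in group) subgroup_centralizer:
  assumes S: "S \<subseteq> carrier G"
  shows "subgroup (centralizer G S) G"
proof (rule subgroupI)
  show "centralizer G S \<noteq> {}"
    using S by (auto simp: centralizer_def intro!: exI[of _ \<one>])
  show "inv g \<in> centralizer G S" if "g \<in> centralizer G S" for g
  proof -
    have "inv g \<otimes> s = s \<otimes> inv g" if s: "s \<in> S" for s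
    proof -
      have g: "g \<in> carrier G" "s \<in> carrier G" "g \<otimes> s = s \<otimes> g"
        using \<open>g \<in> _\<close> s S by (auto simp: centralizer_def)
      have "g \<otimes> (inv g \<otimes> s) = g \<otimes> (s \<otimes> inv g)"
        using g by (simp flip: m_assoc) (simp add: m_assoc)
      then show ?thesis using g by simp
    qed
    then show ?thesis using that by (auto simp: centralizer_def)
  qed
  show "g \<otimes> h \<in> centralizer G S" if "g \<in> centralizer G S" "h \<in> centralizer G S" for g h
  proof -
    have "(g \<otimes> h) \<otimes> s = s \<otimes> (g \<otimes> h)" if "s \<in> S" for s
    proof -
      have "g \<in> carrier G" "h \<in> carrier G" "s \<in> carrier G" "g \<otimes> s = s \<otimes> g" "h \<otimes> s = s \<otimes> h"
        using \<open>g \<in> _\<close> \<open>h \<in> _\<close> \<open>s \<in> S\<close> S by (auto simp: centralizer_def)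
      then show ?thesis by (metis m_assoc)
    qed
    then show ?thesis using that by (auto simp: centralizer_def)
  qed
qed (auto simp: centralizer_def)

text \<open>Split off the cyclic factor of \<open>a\<close>, send \<open>a\<close> to
  \<open>y\<close> and the complement to 1; this is consistent because the order of \<open>y\<close>
  divides \<open>ord a\<close>. The target \<open>K\<close> is separate from \<open>G\<close>
  because the application maps the abelianization back to the original group.\<close>

lemma (in comm_group) exponent_hom:
  assumes fin: "finite (carrier G)"
  obtains a where "a \<in> carrier G" "\<And>x. x \<in> carrier G \<Longrightarrow> x [^] ord a = \<one>"
    "\<And>K y. \<lbrakk>group K; y \<in> carrier K; y [^]\<^bsub>K\<^esub> ord a = \<one>\<^bsub>K\<^esub>\<rbrakk> \<Longrightarrow>
       \<exists>f \<in> hom G K. f a = y \<and> (\<forall>x \<in> carrier G. \<exists>k::int. f x = y [^]\<^bsub>K\<^esub> k)"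
proof -
  obtain a where a: "a \<in> carrier G" "\<And>x. x \<in> carrier G \<Longrightarrow> x [^] ord a = \<one>"
    using exponent_attained[OF fin] by blast
  obtain B where B: "subgroup B G" "\<And>k::int. a [^] k \<in> B \<Longrightarrow> a [^] k = \<one>"
    "\<And>x. x \<in> carrier G \<Longrightarrow> \<exists>k::int. \<exists>b\<in>B. x = a [^] k \<otimes> b"
    using exponent_cyclic_complement[OF fin a] by blast
  note Bc = subgroup.mem_carrier[OF B(1)]
  have "\<exists>f \<in> hom G K. f a = y \<and> (\<forall>x \<in> carrier G. \<exists>k::int. f x = y [^]\<^bsub>K\<^esub> k)"
    if K: "group K" and y: "y \<in> carrier K" and y1: "y [^]\<^bsub>K\<^esub> ord a = \<one>\<^bsub>K\<^esub>" for K :: "('c, 'd) monoid_scheme" and y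
  proof -
    interpret K: group K by fact
    \<comment> \<open>The exponent of \<open>a\<close> is determined only modulo
      \<open>ord a\<close>, so the choice made here does not affect the value.\<close>
    define f where "f x = y [^]\<^bsub>K\<^esub> (SOME k::int. \<exists>b\<in>B. x = a [^] k \<otimes> b)" for x
    have f: "f (a [^] k \<otimes> b) = y [^]\<^bsub>K\<^esub> k" if b: "b \<in> B" for k :: int and b
    proof -
      define l where "l = (SOME l::int. \<exists>c\<in>B. a [^] k \<otimes> b = a [^] l \<otimes> c)"
      have "\<exists>c\<in>B. a [^] k \<otimes> b = a [^] l \<otimes> c"
        unfolding l_def by (rule someI[of "\<lambda>l::int. \<exists>c\<in>B. a [^] k \<otimes> b = a [^] l \<otimes> c" k]) (use b in blast)
      then obtain c where c: "c \<in> B" "a [^] k \<otimes> b = a [^] l \<otimes> c" by blast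
      have "a [^] (k - l) = (a [^] k \<otimes> b) \<otimes> (inv (a [^] l) \<otimes> inv b)"
        using a(1) Bc[OF b] by (simp add: int_pow_diff m_assoc m_lcomm[of b])
      also have "\<dots> = c \<otimes> inv b"
        unfolding c(2) using a(1) Bc[OF b] Bc[OF c(1)] by (simp add: m_ac)
      also have "\<dots> \<in> B"
        by (intro subgroup.m_closed[OF B(1)] subgroup.m_inv_closed[OF B(1)] b c(1))
      finally have "a [^] (k - l) = \<one>" by (rule B(2))
      then have "int (ord a) dvd k - l" using int_pow_eq_id[OF a(1)] by simp
      moreover have "int (K.ord y) dvd int (ord a)" using y1 K.pow_eq_id[OF y] by simp
      ultimately have "y [^]\<^bsub>K\<^esub> l = y [^]\<^bsub>K\<^esub> k" using K.int_pow_eq[OF y] by (meson dvd_trans)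
      then show ?thesis unfolding f_def l_def .
    qed
    have "f \<in> hom G K"
    proof (rule homI)
      fix u v assume "u \<in> carrier G" "v \<in> carrier G"
      then obtain k b l c where u: "u = a [^] (k::int) \<otimes> b" "b \<in> B"
        and v: "v = a [^] (l::int) \<otimes> c" "c \<in> B" using B(3) by metis
      have "u \<otimes> v = a [^] (k + l) \<otimes> (b \<otimes> c)"
        using a(1) u v Bc[OF u(2)] Bc[OF v(2)] by (simp add: int_pow_mult m_ac)
      then show "f (u \<otimes> v) = f u \<otimes>\<^bsub>K\<^esub> f v"
        using f[OF subgroup.m_closed[OF B(1) u(2) v(2)]] f[OF u(2)] f[OF v(2)] u(1) v(1) y
        by (simp add: K.int_pow_mult)
    qed (simp add: f_def y)
    moreover have "f a = y"
      using f[OF subgroup.one_closed[OF B(1)], of 1] a(1) y by simp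
    moreover have "\<exists>k::int. f x = y [^]\<^bsub>K\<^esub> k" for x
      unfolding f_def by (rule exI, rule refl)
    ultimately show ?thesis by blast
  qed
  then show ?thesis using that a by blast
qed

text \<open>The number \<open>n\<close> is the exponent of the abelianization. The endomorphism is
  the projection to the abelianization followed by a map of its cyclic factor onto the group
  generated by \<open>y\<close>.\<close>

lemma (in group) abelianization_exponent_endo:
  assumes fin: "finite (carrier G)"
  obtains n :: nat where "\<And>x. x \<in> carrier G \<Longrightarrow> x [^] n \<in> derived G (carrier G)"
    "\<And>y. \<lbrakk>y \<in> carrier G; y [^] n = \<one>\<rbrakk> \<Longrightarrow>
       \<exists>f \<in> hom G G. \<exists>a \<in> carrier G. f a = y \<and> (\<forall>x \<in> carrier G. \<exists>k::int. f x = y [^] k)"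
proof -
  define D where "D = derived G (carrier G)"
  interpret D: normal D G unfolding D_def by (rule derived_self_is_normal)
  interpret A: comm_group "G Mod D" unfolding D_def by (rule derived_quot_is_comm_group)
  have p: "(#>) D \<in> hom G (G Mod D)" by (rule D.r_coset_hom_Mod)
  interpret p: group_hom G "G Mod D" "(#>) D"
    using p A.group_axioms group_axioms by (simp add: group_hom_def group_hom_axioms_def)
  have surj: "\<exists>g \<in> carrier G. X = D #> g" if "X \<in> carrier (G Mod D)" for X
    using that by (auto simp: carrier_FactGroup)
  have finQ: "finite (carrier (G Mod D))" using fin by (simp add: carrier_FactGroup)
  obtain X where X: "X \<in> carrier (G Mod D)"
      "\<And>Y. Y \<in> carrier (G Mod D) \<Longrightarrow> Y [^]\<^bsub>G Mod D\<^esub> A.ord X = \<one>\<^bsub>G Mod D\<^esub>"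
      and ex: "\<And>K y. \<lbrakk>group K; y \<in> carrier K; y [^]\<^bsub>K\<^esub> A.ord X = \<one>\<^bsub>K\<^esub>\<rbrakk> \<Longrightarrow>
       \<exists>f \<in> hom (G Mod D) (K :: ('a, 'b) monoid_scheme).
         f X = y \<and> (\<forall>x \<in> carrier (G Mod D). \<exists>k::int. f x = y [^]\<^bsub>K\<^esub> k)"
    by (rule A.exponent_hom[OF finQ]) (rule that)
  obtain a where a: "a \<in> carrier G" "X = D #> a" using surj[OF X(1)] by blast
  have 1: "x [^] A.ord X \<in> D" if "x \<in> carrier G" for x
  proof -
    have "D #> (x [^] A.ord X) = D"
      using X(2)[OF p.hom_closed[OF that]] p.hom_nat_pow[OF that] by simp
    then show ?thesis using rcos_self[OF nat_pow_closed[OF that] D.subgroup_axioms, of "A.ord X"] by simp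
  qed
  have 2: "\<exists>f \<in> hom G G. \<exists>a \<in> carrier G. f a = y \<and> (\<forall>x \<in> carrier G. \<exists>k::int. f x = y [^] k)"
    if y: "y \<in> carrier G" "y [^] A.ord X = \<one>" for y
  proof -
    obtain f where f: "f \<in> hom (G Mod D) G" "f X = y"
      "\<And>x. x \<in> carrier (G Mod D) \<Longrightarrow> \<exists>k::int. f x = y [^] k"
      using ex[OF group_axioms y] by blast
    have "f \<circ> (#>) D \<in> hom G G" by (rule Group.hom_compose[OF p f(1)])
    then show ?thesis using a f p.hom_closed by (intro bexI[of _ "f \<circ> (#>) D"] bexI[of _ a]) auto
  qed
  show ?thesis by (rule that[unfolded D_def[symmetric], OF 1 2])
qed

subsection \<open>2-Engel groups\<close>

text \<open>
  Additively: expand \<open>P\<^sup>2 x = 0\<close> for \<open>P = (1 + Y)(1 + Z) - 1\<close>, then multiply by \<open>Y\<close> and by \<open>Z\<close>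
  to make the terms of higher degree vanish.
\<close>

lemma (in comm_group) square_zero_homs_anticommute:
  assumes Y: "Y \<in> hom G G" and Z: "Z \<in> hom G G"
    and YY: "\<And>m. m \<in> carrier G \<Longrightarrow> Y (Y m) = \<one>" and ZZ: "\<And>m. m \<in> carrier G \<Longrightarrow> Z (Z m) = \<one>"
    and P: "\<And>m. m \<in> carrier G \<Longrightarrow> P m = Y (Z m) \<otimes> Z m \<otimes> Y m"
    and x: "x \<in> carrier G" and PP: "P (P x) = \<one>"
  shows "Y (Z x) \<otimes> Z (Y x) = \<one>"
proof -
  interpret Y: group_hom G G Y
    using Y group_axioms by (simp add: group_hom_def group_hom_axioms_def)
  interpret Z: group_hom G G Z
    using Z group_axioms by (simp add: group_hom_def group_hom_axioms_def)
  \<comment> \<open>Of the nine terms of \<open>P (P x)\<close>, the four containing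
    \<open>Y\<close> or \<open>Z\<close> twice in a row vanish.\<close>
  have eq: "Y (Z x) \<otimes> Z (Y x) \<otimes> Z (Y (Z x)) \<otimes> Y (Z (Y x)) \<otimes> Y (Z (Y (Z x))) = \<one>"
    using PP x by (simp add: P YY ZZ m_ac)
  have "Y (Y (Z x) \<otimes> Z (Y x) \<otimes> Z (Y (Z x)) \<otimes> Y (Z (Y x)) \<otimes> Y (Z (Y (Z x)))) = \<one>"
    unfolding eq by simp
  then have "Y (Z (Y x)) \<otimes> Y (Z (Y (Z x))) = \<one>"
    using x by (simp add: YY)
  then have eq2: "Y (Z x) \<otimes> Z (Y x) \<otimes> Z (Y (Z x)) = \<one>"
    using eq x by (simp add: m_assoc)
  have "Z (Y (Z x) \<otimes> Z (Y x) \<otimes> Z (Y (Z x))) = \<one>"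
    unfolding eq2 by simp
  then have "Z (Y (Z x)) = \<one>"
    using x by (simp add: ZZ)
  then show ?thesis using eq2 x by simp
qed

section \<open>Commutator identities in arbitrary groups\<close>

context group begin

text \<open>Associating to the right makes \<open>x \<diamondop> y \<diamondop> z\<close> the
  commutator [x, [y, z]]; the operator binds tighter than the group product.\<close>

abbreviation commutator_op (infixr "\<diamondop>" 72) where
  "x \<diamondop> y \<equiv> commutator G x y"

lemma commutator_closed [simp, intro]:
  "\<lbrakk>x \<in> carrier G; y \<in> carrier G\<rbrakk> \<Longrightarrow> x \<diamondop> y \<in> carrier G"
  by (simp add: commutator_def)

lemma inv_cancel_left:
  "\<lbrakk>x \<in> carrier G; y \<in> carrier G\<rbrakk> \<Longrightarrow> x \<otimes> (inv x \<otimes> y) = y"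
  "\<lbrakk>x \<in> carrier G; y \<in> carrier G\<rbrakk> \<Longrightarrow> inv x \<otimes> (x \<otimes> y) = y"
  by (simp_all flip: m_assoc)

lemma commutator_mult_swap:
  "\<lbrakk>x \<in> carrier G; y \<in> carrier G\<rbrakk> \<Longrightarrow> (x \<diamondop> y) \<otimes> (y \<otimes> x) = x \<otimes> y"
  by (simp add: commutator_def m_assoc inv_cancel_left)

lemma commutator_eq_one_iff:
  assumes "x \<in> carrier G" "y \<in> carrier G"
  shows "x \<diamondop> y = \<one> \<longleftrightarrow> x \<otimes> y = y \<otimes> x"
  using commutator_mult_swap[OF assms] assms by (metis commutator_closed l_one m_closed r_cancel_one')

lemma inv_commutator:
  "\<lbrakk>x \<in> carrier G; y \<in> carrier G\<rbrakk> \<Longrightarrow> inv (x \<diamondop> y) = y \<diamondop> x"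
  by (simp add: commutator_def inv_mult_group m_assoc)

lemma commutator_mult_right:
  "\<lbrakk>x \<in> carrier G; y \<in> carrier G; z \<in> carrier G\<rbrakk> \<Longrightarrow>
    x \<diamondop> (y \<otimes> z) = (x \<diamondop> y) \<otimes> (y \<otimes> (x \<diamondop> z) \<otimes> inv y)"
  by (simp add: commutator_def inv_mult_group m_assoc inv_cancel_left)

text \<open>The conjugate of [y, z] by x is written as [x, [y, z]] [y, z]. With X and Y for
  commutation with x and y, the operator of the product becomes XY + Y + X on an abelian normal
  subgroup, which is the form of \<open>P\<close> in
  \<open>square_zero_homs_anticommute\<close>.\<close>

lemma commutator_mult_left:
  "\<lbrakk>x \<in> carrier G; y \<in> carrier G; z \<in> carrier G\<rbrakk> \<Longrightarrow>
    (x \<otimes> y) \<diamondop> z = (x \<diamondop> y \<diamondop> z) \<otimes> (y \<diamondop> z) \<otimes> (x \<diamondop> z)"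
  by (simp add: commutator_def inv_mult_group m_assoc inv_cancel_left)

text \<open>The conjugate in \<open>commutator_mult_right\<close> stays in \<open>M\<close>, where
  conjugation by an element of \<open>M\<close> has no effect. So \<open>M\<close> is a module on
  which \<open>y\<close> acts as conjugation minus the identity.\<close>

lemma normal_abelian_commutator_hom:
  assumes M: "M \<lhd> G" and ab: "comm_group (G\<lparr>carrier := M\<rparr>)" and y: "y \<in> carrier G"
  shows "(\<lambda>m. y \<diamondop> m) \<in> hom (G\<lparr>carrier := M\<rparr>) (G\<lparr>carrier := M\<rparr>)"
proof -
  interpret M: normal M G by fact
  have cl: "y \<diamondop> m \<in> M" if "m \<in> M" for m
    unfolding commutator_def using that y by (simp add: M.inv_op_closed2)
  have "y \<diamondop> (m \<otimes> n) = (y \<diamondop> m) \<otimes> (y \<diamondop> n)" if "m \<in> M" "n \<in> M" for m n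
  proof -
    have "m \<otimes> (y \<diamondop> n) = (y \<diamondop> n) \<otimes> m"
      using comm_groupE(4)[OF ab] that cl by simp
    then show ?thesis
      using that y by (simp add: commutator_mult_right m_assoc)
  qed
  then show ?thesis using cl by (auto intro!: homI)
qed

end

section \<open>Levi's theorem on 2-Engel groups\<close>

text \<open>The law [x, [x, y]] = 1 in the form that inner automorphisms of an E-group deliver:
  every element commutes with its conjugates.\<close>

locale two_engel = group G for G (structure) +
  assumes conj_commute: "\<lbrakk>x \<in> carrier G; g \<in> carrier G\<rbrakk> \<Longrightarrow>
    x \<otimes> (g \<otimes> x \<otimes> inv g) = (g \<otimes> x \<otimes> inv g) \<otimes> x"
begin

text \<open>The commutator [x, y] is \<open>x\<close> times the inverse of a conjugate of
  \<open>x\<close>, and both factors commute with \<open>x\<close>.\<close>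

lemma engel [simp]:
  assumes x: "x \<in> carrier G" and y: "y \<in> carrier G"
  shows "x \<diamondop> x \<diamondop> y = \<one>"
proof -
  have c: "x \<in> centralizer G {x}" "y \<otimes> x \<otimes> inv y \<in> centralizer G {x}"
    using conj_commute x y by (auto simp: centralizer_def)
  have "x \<otimes> inv (y \<otimes> x \<otimes> inv y) \<in> centralizer G {x}"
    by (intro subgroup.m_closed[OF subgroup_centralizer] subgroup.m_inv_closed[OF subgroup_centralizer] c)
      (use x in auto)
  moreover have "x \<otimes> inv (y \<otimes> x \<otimes> inv y) = x \<diamondop> y"
    using x y by (simp add: commutator_def inv_mult_group m_assoc)
  ultimately show ?thesis
    using x y by (simp add: centralizer_def commutator_eq_one_iff)
qed

text \<open>The left side is the conjugate of [y, x] by the inverse of \<open>y\<close>, and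
  \<open>y\<close> commutes with [y, x].\<close>

lemma commutator_inv_right:
  assumes x: "x \<in> carrier G" and y: "y \<in> carrier G"
  shows "x \<diamondop> inv y = inv (x \<diamondop> y)"
proof -
  have "y \<otimes> (y \<diamondop> x) = (y \<diamondop> x) \<otimes> y"
    using engel[OF y x] x y by (simp add: commutator_eq_one_iff del: engel)
  then have "inv y \<otimes> (y \<diamondop> x) \<otimes> y = y \<diamondop> x"
    using x y by (simp add: m_assoc inv_cancel_left flip: \<open>y \<otimes> (y \<diamondop> x) = (y \<diamondop> x) \<otimes> y\<close>)
  moreover have "inv y \<otimes> (y \<diamondop> x) \<otimes> y = x \<diamondop> inv y"
    using x y by (simp add: commutator_def m_assoc inv_cancel_left)
  ultimately show ?thesis using x y by (simp add: inv_commutator)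
qed

text \<open>
  The double centralizer of the conjugacy class of \<open>x\<close> is a convenient substitute for its normal closure:
  conjugates of \<open>x\<close> commute with each other, so it is abelian.
\<close>

lemma abelian_normal_containing:
  assumes x: "x \<in> carrier G"
  obtains M where "M \<lhd> G" "x \<in> M" "comm_group (G\<lparr>carrier := M\<rparr>)"
proof -
  define X where "X = {g \<otimes> x \<otimes> inv g | g. g \<in> carrier G}"
  have X: "X \<subseteq> carrier G" using x unfolding X_def by auto
  have conjX: "g \<otimes> s \<otimes> inv g \<in> X" if s: "s \<in> X" and g: "g \<in> carrier G" for s g
  proof -
    obtain h where h: "h \<in> carrier G" "s = h \<otimes> x \<otimes> inv h" using s unfolding X_def by auto
    then have "g \<otimes> s \<otimes> inv g = (g \<otimes> h) \<otimes> x \<otimes> inv (g \<otimes> h)"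
      using x g by (simp add: inv_mult_group m_assoc)
    then show ?thesis using h g unfolding X_def by blast
  qed
  \<comment> \<open>Applied to \<open>X\<close> and then to its centralizer, this makes the double
    centralizer normal.\<close>
  have conjC: "g \<otimes> c \<otimes> inv g \<in> centralizer G S"
    if S: "S \<subseteq> carrier G" "\<And>s g. s \<in> S \<Longrightarrow> g \<in> carrier G \<Longrightarrow> g \<otimes> s \<otimes> inv g \<in> S"
      and c: "c \<in> centralizer G S" and g: "g \<in> carrier G" for S c g
  proof -
    have c': "c \<in> carrier G" using c by (simp add: centralizer_def)
    have "(g \<otimes> c \<otimes> inv g) \<otimes> s = s \<otimes> (g \<otimes> c \<otimes> inv g)" if s: "s \<in> S" for s
    proof -
      have s': "s \<in> carrier G" using s S by auto
      have "inv g \<otimes> s \<otimes> g \<in> S" using S(2)[OF s inv_closed[OF g]] g by simp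
      then have "c \<otimes> (inv g \<otimes> s \<otimes> g) = (inv g \<otimes> s \<otimes> g) \<otimes> c"
        using c by (auto simp: centralizer_def)
      then have "g \<otimes> (c \<otimes> (inv g \<otimes> s \<otimes> g)) \<otimes> inv g = g \<otimes> ((inv g \<otimes> s \<otimes> g) \<otimes> c) \<otimes> inv g"
        by simp
      then show ?thesis using c' g s' by (simp add: m_assoc inv_cancel_left)
    qed
    then show ?thesis using c' g by (simp add: centralizer_def)
  qed
  define M where "M = centralizer G (centralizer G X)"
  have CX: "centralizer G X \<subseteq> carrier G" by (auto simp: centralizer_def)
  have XC: "X \<subseteq> centralizer G X"
  proof
    fix s assume s: "s \<in> X"
    have "s \<otimes> t = t \<otimes> s" if t: "t \<in> X" for t
    proof -
      obtain h where h: "h \<in> carrier G" "s = h \<otimes> x \<otimes> inv h" using s unfolding X_def by auto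
      obtain k where k: "k \<in> carrier G" "t = k \<otimes> x \<otimes> inv k" using t unfolding X_def by auto
      have "t = (k \<otimes> inv h) \<otimes> s \<otimes> inv (k \<otimes> inv h)"
        unfolding h k using x h k by (simp add: inv_mult_group m_assoc inv_cancel_left)
      then show ?thesis using conj_commute[of s "k \<otimes> inv h"] h k x by auto
    qed
    then show "s \<in> centralizer G X" using s X by (auto simp: centralizer_def)
  qed
  have sub: "subgroup M G" unfolding M_def by (rule subgroup_centralizer[OF CX])
  have "M \<lhd> G"
    unfolding normal_inv_iff
  proof (intro conjI ballI)
    fix g h assume "g \<in> carrier G" "h \<in> M"
    then show "g \<otimes> h \<otimes> inv g \<in> M"
      unfolding M_def using conjC[OF CX conjC[OF X conjX]] by blast
  qed (rule sub)
  moreover have "x \<in> M"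
  proof -
    have "\<one> \<otimes> x \<otimes> inv \<one> \<in> X" unfolding X_def by blast
    then have "x \<in> X" using x by simp
    then show ?thesis using x unfolding M_def by (auto simp: centralizer_def)
  qed
  moreover have "comm_group (G\<lparr>carrier := M\<rparr>)"
  proof (rule group.group_comm_groupI[OF subgroup_imp_group[OF sub]])
    \<comment> \<open>Since \<open>X\<close> centralizes itself, the double centralizer lies inside
      the single one, and therefore commutes with itself.\<close>
    have "M \<subseteq> centralizer G X"
      using XC CX unfolding M_def by (auto simp: centralizer_def)
    then show "u \<otimes>\<^bsub>G\<lparr>carrier := M\<rparr>\<^esub> v = v \<otimes>\<^bsub>G\<lparr>carrier := M\<rparr>\<^esub> u"
      if "u \<in> carrier (G\<lparr>carrier := M\<rparr>)" "v \<in> carrier (G\<lparr>carrier := M\<rparr>)" for u v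
      using that unfolding M_def by (auto simp: centralizer_def)
  qed
  ultimately show ?thesis by (rule that)
qed

text \<open>On an abelian normal subgroup containing \<open>z\<close>, commutation with
  \<open>x\<close>, with \<open>y\<close> and with \<open>x \<otimes> y\<close> are operators of
  square zero by the Engel law, so the first two anticommute.\<close>

lemma commutator_swap_left:
  assumes x: "x \<in> carrier G" and y: "y \<in> carrier G" and z: "z \<in> carrier G"
  shows "x \<diamondop> y \<diamondop> z = inv (y \<diamondop> x \<diamondop> z)"
proof -
  obtain M where M: "M \<lhd> G" "z \<in> M" "comm_group (G\<lparr>carrier := M\<rparr>)"
    using abelian_normal_containing[OF z] by blast
  interpret nM: normal M G by fact
  interpret M: comm_group "G\<lparr>carrier := M\<rparr>" by fact
  have "(x \<diamondop> y \<diamondop> z) \<otimes>\<^bsub>G\<lparr>carrier := M\<rparr>\<^esub> (y \<diamondop> x \<diamondop> z) = \<one>\<^bsub>G\<lparr>carrier := M\<rparr>\<^esub>"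
  proof (rule M.square_zero_homs_anticommute[where P = "\<lambda>m. (x \<otimes> y) \<diamondop> m"])
    show "(x \<otimes> y) \<diamondop> (x \<otimes> y) \<diamondop> z = \<one>\<^bsub>G\<lparr>carrier := M\<rparr>\<^esub>" using x y z by simp
  qed (use M x y in \<open>simp_all add: normal_abelian_commutator_hom commutator_mult_left\<close>)
  then show ?thesis
    using x y z by (simp add: inv_equality)
qed

text \<open>Together with \<open>commutator_swap_left\<close>, this makes every transposition of
  arguments invert the triple commutator.\<close>

lemma commutator_swap_right:
  assumes x: "x \<in> carrier G" and y: "y \<in> carrier G" and z: "z \<in> carrier G"
  shows "x \<diamondop> y \<diamondop> z = inv (x \<diamondop> z \<diamondop> y)"
  using commutator_inv_right[of x "z \<diamondop> y"] assms by (simp add: inv_commutator)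

lemma commutator_rotate:
  assumes x: "x \<in> carrier G" and y: "y \<in> carrier G" and z: "z \<in> carrier G"
  shows "x \<diamondop> y \<diamondop> z = y \<diamondop> z \<diamondop> x"
  using commutator_swap_left[OF x y z] commutator_swap_right[OF y x z] assms by simp

text \<open>
  With \<open>k = [y, z]\<close>, let both sides of \<open>k z y = y z\<close> act on an abelian normal subgroup containing \<open>x\<close>.
\<close>

lemma commutator_cubed:
  assumes x: "x \<in> carrier G" and y: "y \<in> carrier G" and z: "z \<in> carrier G"
  shows "(x \<diamondop> y \<diamondop> z) [^] (3::nat) = \<one>"
proof -
  obtain M where M: "M \<lhd> G" "x \<in> M" "comm_group (G\<lparr>carrier := M\<rparr>)"
    using abelian_normal_containing[OF x] by blast
  interpret nM: normal M G by fact
  interpret M: comm_group "G\<lparr>carrier := M\<rparr>" by fact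
  have cl: "g \<diamondop> m \<in> M" if "g \<in> carrier G" "m \<in> M" for g m
    using hom_in_carrier[OF normal_abelian_commutator_hom[OF M(1,3) that(1)]] that(2) by simp
  have ac: "m \<otimes> n = n \<otimes> m" "m \<otimes> (n \<otimes> k) = n \<otimes> (m \<otimes> k)" if "m \<in> M" "n \<in> M" "k \<in> M" for m n k
    using M.m_comm[of m n] M.m_lcomm[of m n k] that by simp_all
  define k where "k = y \<diamondop> z"
  have k: "k \<in> carrier G" unfolding k_def using y z by simp
  have yk: "y \<diamondop> k = \<one>" unfolding k_def using y z by simp
  have zk: "z \<diamondop> k = \<one>"
    unfolding k_def using commutator_inv_right[of z "z \<diamondop> y"] y z by (simp add: inv_commutator)
  \<comment> \<open>Since \<open>k\<close> commutes with \<open>z\<close>, the commutator [m,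
    [z, k]] is trivial, and permuting arguments transfers this to [k, [z, m]].\<close>
  have kz0: "k \<diamondop> z \<diamondop> m = \<one>" if "m \<in> carrier G" for m
    using commutator_rotate[of m k z] commutator_swap_right[of m k z] that k z zk
    by (simp add: commutator_def[of G m])
  have ky0: "k \<diamondop> y \<diamondop> m = \<one>" if "m \<in> carrier G" for m
    using commutator_rotate[of m k y] commutator_swap_right[of m k y] that k y yk
    by (simp add: commutator_def[of G m])
  have "(k \<otimes> (z \<otimes> y)) \<diamondop> x = (y \<otimes> z) \<diamondop> x"
    unfolding k_def using y z by (simp add: commutator_mult_swap)
  \<comment> \<open>The mixed term therefore drops out, and \<open>k\<close> contributes only the
    factor \<open>k \<diamondop> x\<close>, the inverse of [x, [y, z]].\<close>
  moreover have "k \<diamondop> (z \<otimes> y) \<diamondop> x = \<one>"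
  proof -
    have "k \<diamondop> (z \<otimes> y) \<diamondop> x = (k \<diamondop> z \<diamondop> y \<diamondop> x) \<otimes> (k \<diamondop> y \<diamondop> x) \<otimes> (k \<diamondop> z \<diamondop> x)"
      using hom_mult[OF normal_abelian_commutator_hom[OF M(1,3) k]] x y z M(2)
      by (simp add: commutator_mult_left cl)
    then show ?thesis using x y z by (simp add: kz0 ky0)
  qed
  ultimately have "(z \<diamondop> y \<diamondop> x) \<otimes> (y \<diamondop> x) \<otimes> (z \<diamondop> x) \<otimes> (k \<diamondop> x) = (y \<diamondop> z \<diamondop> x) \<otimes> (z \<diamondop> x) \<otimes> (y \<diamondop> x)"
    using x y z k M(2) by (simp add: commutator_mult_left m_assoc)
  moreover have t1: "y \<diamondop> z \<diamondop> x = x \<diamondop> y \<diamondop> z"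
    using commutator_rotate[OF x y z] by simp
  moreover have "z \<diamondop> y \<diamondop> x = inv (x \<diamondop> y \<diamondop> z)"
    using commutator_swap_left[OF z y x] t1 by simp
  moreover have "k \<diamondop> x = inv (x \<diamondop> y \<diamondop> z)"
    unfolding k_def using x y z by (simp add: inv_commutator)
  moreover define t where "t = x \<diamondop> y \<diamondop> z"
  ultimately have eq: "inv t \<otimes> (y \<diamondop> x) \<otimes> (z \<diamondop> x) \<otimes> inv t = t \<otimes> (z \<diamondop> x) \<otimes> (y \<diamondop> x)"
    by simp
  have t: "t \<in> M" unfolding t_def t1[symmetric] using cl y z M(2) by simp
  have "((y \<diamondop> x) \<otimes> (z \<diamondop> x)) \<otimes> (inv t \<otimes> inv t) = ((y \<diamondop> x) \<otimes> (z \<diamondop> x)) \<otimes> t"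
    using eq t cl[OF y M(2)] cl[OF z M(2)] by (simp add: m_assoc ac)
  then have "inv t \<otimes> inv t = t" using t x y z by simp
  then have "t \<otimes> t \<otimes> t = \<one>"
    using t by (metis nM.mem_carrier inv_closed inv_mult_group inv_inv r_inv m_closed)
  then show ?thesis using t unfolding t_def[symmetric] by (simp add: numeral_3_eq_3)
qed

text \<open>
  Since \<open>[x, [y, [z, w]]]\<close> is alternating, the even permutation exchanging \<open>(x, y)\<close> with \<open>(z, w)\<close>
  fixes it; but it also inverts \<open>[[x, y], [z, w]]\<close>. So its square is trivial as well as its cube.
\<close>

lemma commutator4_trivial:
  assumes x: "x \<in> carrier G" and y: "y \<in> carrier G" and z: "z \<in> carrier G" and w: "w \<in> carrier G"
  shows "x \<diamondop> y \<diamondop> z \<diamondop> w = \<one>"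
proof -
  define F where "F = x \<diamondop> y \<diamondop> z \<diamondop> w"
  have F: "F \<in> carrier G" unfolding F_def using assms by simp
  have "F = (z \<diamondop> w) \<diamondop> x \<diamondop> y"
    unfolding F_def using commutator_rotate[of "z \<diamondop> w" x y] assms by simp
  then have 1: "inv F = (x \<diamondop> y) \<diamondop> z \<diamondop> w"
    using assms by (simp add: inv_commutator)
  \<comment> \<open>Four adjacent transpositions, each inverting the value, carry x, y, z, w to z,
    w, x, y.\<close>
  have "F = inv (x \<diamondop> z \<diamondop> y \<diamondop> w)"
    unfolding F_def using assms by (simp add: commutator_swap_left[of y z w] commutator_inv_right)
  also have "\<dots> = z \<diamondop> x \<diamondop> y \<diamondop> w"
    using commutator_swap_left[of z x "y \<diamondop> w"] assms by simp
  also have "\<dots> = inv (z \<diamondop> x \<diamondop> w \<diamondop> y)"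
    using assms by (simp add: commutator_swap_right[of x y w] commutator_inv_right)
  also have "\<dots> = z \<diamondop> w \<diamondop> x \<diamondop> y"
    using assms by (simp add: commutator_swap_left[of x w y] commutator_inv_right)
  also have "\<dots> = (x \<diamondop> y) \<diamondop> z \<diamondop> w"
    using commutator_rotate[of "x \<diamondop> y" z w] assms by simp
  finally have "inv F = F" using 1 by simp
  then have "F \<otimes> F = \<one>" using F by (metis r_inv)
  moreover have "F [^] (3::nat) = \<one>"
    unfolding F_def using commutator_cubed assms by simp
  ultimately show ?thesis using F unfolding F_def[symmetric] by (simp add: numeral_3_eq_3)
qed

section \<open>Multilinearity and reduction to generators\<close>

lemma commutator3_commute:
  assumes "x \<in> carrier G" "y \<in> carrier G" "z \<in> carrier G" "g \<in> carrier G"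
  shows "g \<otimes> (x \<diamondop> y \<diamondop> z) = (x \<diamondop> y \<diamondop> z) \<otimes> g"
  using commutator4_trivial[of g x y z] assms by (simp add: commutator_eq_one_iff)

text \<open>The commutator [y, uv] is [y, u] [y, v] up to the central factor [u, [y, v]], which
  commutation with \<open>x\<close> kills.\<close>

lemma commutator3_mult:
  assumes x: "x \<in> carrier G" and y: "y \<in> carrier G" and u: "u \<in> carrier G" and v: "v \<in> carrier G"
  shows "x \<diamondop> y \<diamondop> (u \<otimes> v) = (x \<diamondop> y \<diamondop> u) \<otimes> (x \<diamondop> y \<diamondop> v)"
proof -
  have mult: "x \<diamondop> (m \<otimes> n) = (x \<diamondop> m) \<otimes> (x \<diamondop> n)"
    if "m \<in> carrier G" "n \<in> carrier G" "m \<otimes> (x \<diamondop> n) = (x \<diamondop> n) \<otimes> m" for m n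
    using that x by (simp add: commutator_mult_right m_assoc)
  define w where "w = y \<diamondop> v"
  have w: "w \<in> carrier G" unfolding w_def using y v by simp
  have "u \<otimes> w \<otimes> inv u = (u \<diamondop> w) \<otimes> w"
    using u w by (simp add: commutator_def m_assoc)
  then have "y \<diamondop> (u \<otimes> v) = (y \<diamondop> u) \<otimes> ((u \<diamondop> w) \<otimes> w)"
    using y u v unfolding w_def by (simp add: commutator_mult_right)
  moreover have "x \<diamondop> ((u \<diamondop> w) \<otimes> w) = x \<diamondop> w"
    using mult[of "u \<diamondop> w" w] commutator3_commute[OF x y v, of "u \<diamondop> w"] commutator4_trivial[OF x u y v]
      x u w unfolding w_def[symmetric] by simp
  moreover have "(y \<diamondop> u) \<otimes> (x \<diamondop> w) = (x \<diamondop> w) \<otimes> (y \<diamondop> u)"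
    unfolding w_def using commutator3_commute[OF x y v] y u by simp
  ultimately show ?thesis
    using mult[of "y \<diamondop> u" "(u \<diamondop> w) \<otimes> w"] x y u w unfolding w_def[symmetric] by simp
qed

text \<open>The last arguments that lead into \<open>K\<close> form a subgroup. Permuting arguments
  brings each position to the last place in turn, so generators are replaced by arbitrary elements
  one position at a time.\<close>

lemma commutator3_generate:
  assumes K: "subgroup K G" and S: "S \<subseteq> carrier G"
    and base: "\<And>p q r. \<lbrakk>p \<in> S; q \<in> S; r \<in> S\<rbrakk> \<Longrightarrow> p \<diamondop> q \<diamondop> r \<in> K"
    and xyz: "x \<in> generate G S" "y \<in> generate G S" "z \<in> generate G S"
  shows "x \<diamondop> y \<diamondop> z \<in> K"
proof -
  have gen: "u \<in> carrier G" if "u \<in> generate G S" for u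
    using generate_in_carrier[OF S that] .
  have Sc: "s \<in> carrier G" if "s \<in> S" for s
    using S that by blast
  have ext: "x \<diamondop> y \<diamondop> z \<in> K"
    if x: "x \<in> carrier G" and y: "y \<in> carrier G" and z: "z \<in> generate G S"
      and bs: "\<And>s. s \<in> S \<Longrightarrow> x \<diamondop> y \<diamondop> s \<in> K" for x y z
  proof -
    have "subgroup {u \<in> carrier G. x \<diamondop> y \<diamondop> u \<in> K} G"
    proof (rule subgroupI)
      have "x \<diamondop> y \<diamondop> \<one> = \<one>" using x y by (simp add: commutator_def)
      then show "{u \<in> carrier G. x \<diamondop> y \<diamondop> u \<in> K} \<noteq> {}"
        using subgroup.one_closed[OF K] by force
    qed (use x y subgroup.m_closed[OF K] subgroup.m_inv_closed[OF K] in
        \<open>auto simp: commutator3_mult commutator_inv_right\<close>)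
    then have "generate G S \<subseteq> {u \<in> carrier G. x \<diamondop> y \<diamondop> u \<in> K}"
      by (rule generate_subgroup_incl[rotated]) (use S bs in auto)
    then show ?thesis using z by blast
  qed
  have 1: "p \<diamondop> q \<diamondop> u \<in> K" if "p \<in> S" "q \<in> S" "u \<in> generate G S" for p q u
    using ext[of p q u] that base S by blast
  have 2: "p \<diamondop> u \<diamondop> v \<in> K" if "p \<in> S" "u \<in> generate G S" "v \<in> generate G S" for p u v
  proof (rule ext)
    fix s assume "s \<in> S"
    then show "p \<diamondop> u \<diamondop> s \<in> K"
      using 1[of p s u] commutator_swap_right[of p u s] that Sc gen subgroup.m_inv_closed[OF K] by auto
  qed (use that Sc gen in auto)
  show ?thesis
  proof (rule ext)
    fix s assume "s \<in> S"
    then show "x \<diamondop> y \<diamondop> s \<in> K"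
      using 2[of s x y] commutator_rotate[of s x y] xyz Sc gen by auto
  qed (use xyz gen in auto)
qed

text \<open>As \<open>x\<close> commutes with [x, y], so does each power of \<open>x\<close>, and
  the correction term in \<open>commutator_mult_left\<close> vanishes.\<close>

lemma commutator_nat_pow:
  assumes x: "x \<in> carrier G" and y: "y \<in> carrier G"
  shows "(x [^] (n::nat)) \<diamondop> y = (x \<diamondop> y) [^] n"
proof (induction n)
  case 0
  then show ?case using y by (simp add: commutator_def)
next
  case (Suc n)
  have "x \<otimes> (x \<diamondop> y) = (x \<diamondop> y) \<otimes> x"
    using engel[OF x y] x y by (simp add: commutator_eq_one_iff del: engel)
  then have "x [^] n \<diamondop> x \<diamondop> y = \<one>"
    using x y by (simp add: commutator_eq_one_iff group_commutes_pow)
  moreover have "x [^] Suc n \<diamondop> y = (x [^] n \<diamondop> x \<diamondop> y) \<otimes> (x \<diamondop> y) \<otimes> (x [^] n \<diamondop> y)"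
    using x y by (simp add: commutator_mult_left)
  ultimately show ?case
    using x y Suc by (simp flip: nat_pow_Suc2)
qed

section \<open>Class 2 for three generators\<close>

text \<open>The intended \<open>n\<close> is the exponent of the abelianization;
  \<open>central\<close> carries what the E-property gives beyond the 2-Engel law.\<close>

lemma three_generator_class2:
  assumes abc: "a \<in> carrier G" "b \<in> carrier G" "c \<in> carrier G"
    and gen: "generate G {a, b, c} = carrier G"
    and pow: "\<And>x. x \<in> carrier G \<Longrightarrow> x [^] (n::nat) \<in> derived G (carrier G)"
    and central: "\<And>x g. \<lbrakk>x \<in> carrier G; g \<in> carrier G; x [^] n = \<one>\<rbrakk> \<Longrightarrow> g \<otimes> x = x \<otimes> g"
    and xyz: "x \<in> carrier G" "y \<in> carrier G" "z \<in> carrier G"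
  shows "x \<diamondop> y \<diamondop> z = \<one>"
proof -
  define t where "t = a \<diamondop> b \<diamondop> c"
  have t: "t \<in> carrier G" unfolding t_def using abc by simp
  define U where "U = generate G {t}"
  have U: "subgroup U G" unfolding U_def using t by (intro generate_is_subgroup) simp
  have U_pow: "U = {t [^] (k::int) | k. k \<in> UNIV}" unfolding U_def by (rule generate_pow[OF t])
  have tU: "t \<in> U" unfolding U_def by (rule generate.incl) simp
  have perm: "b \<diamondop> c \<diamondop> a = t" "c \<diamondop> a \<diamondop> b = t" "a \<diamondop> c \<diamondop> b = inv t"
    "b \<diamondop> a \<diamondop> c = inv t" "c \<diamondop> b \<diamondop> a = inv t"
  proof -
    show *: "b \<diamondop> c \<diamondop> a = t" unfolding t_def using commutator_rotate[of a b c] abc by simp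
    show "c \<diamondop> a \<diamondop> b = t" unfolding t_def using commutator_rotate[of c a b] abc by simp
    show "a \<diamondop> c \<diamondop> b = inv t" unfolding t_def using commutator_swap_right[of a c b] abc by simp
    show "b \<diamondop> a \<diamondop> c = inv t" unfolding t_def using commutator_swap_left[of b a c] abc by simp
    show "c \<diamondop> b \<diamondop> a = inv t" unfolding *[symmetric] using commutator_swap_left[of c b a] abc by simp
  qed
  \<comment> \<open>With \<open>engel\<close> and \<open>perm\<close>, this evaluates the triple
    commutator on all 27 triples of generators.\<close>
  have rep: "p \<diamondop> q \<diamondop> q = \<one>" "p \<diamondop> q \<diamondop> p = \<one>" if "p \<in> carrier G" "q \<in> carrier G" for p q
  proof -
    show "p \<diamondop> q \<diamondop> q = \<one>" using that by (simp add: commutator_def m_assoc inv_cancel_left)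
    show "p \<diamondop> q \<diamondop> p = \<one>" using commutator_swap_right[of p q p] that by simp
  qed
  have T: "x \<diamondop> y \<diamondop> z \<in> U" if "x \<in> carrier G" "y \<in> carrier G" "z \<in> carrier G" for x y z
  proof (rule commutator3_generate[OF U, of "{a, b, c}"])
    fix p q r assume "p \<in> {a, b, c}" "q \<in> {a, b, c}" "r \<in> {a, b, c}"
    then show "p \<diamondop> q \<diamondop> r \<in> U"
      using abc tU subgroup.m_inv_closed[OF U tU] subgroup.one_closed[OF U]
      by (auto simp: perm rep t_def[symmetric])
  qed (use abc gen that in auto)
  \<comment> \<open>Commutators have this property by \<open>T\<close>, and the elements having it
    form a subgroup. It will be applied to the n-th power of \<open>a\<close>.\<close>
  have der: "g \<diamondop> s \<in> U" if g: "g \<in> derived G (carrier G)" and s: "s \<in> carrier G" for g s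
  proof -
    have "subgroup {g \<in> carrier G. g \<diamondop> s \<in> U} G"
    proof (rule subgroupI)
      have "\<one> \<diamondop> s = \<one>" using s by (simp add: commutator_def)
      then show "{g \<in> carrier G. g \<diamondop> s \<in> U} \<noteq> {}" using subgroup.one_closed[OF U] by force
      show "inv g \<in> {g \<in> carrier G. g \<diamondop> s \<in> U}" if "g \<in> {g \<in> carrier G. g \<diamondop> s \<in> U}" for g
      proof -
        have g: "g \<in> carrier G" "g \<diamondop> s \<in> U" using that by auto
        have "inv g \<diamondop> s = inv (s \<diamondop> inv g)" using g s by (simp add: inv_commutator)
        also have "\<dots> = inv (g \<diamondop> s)" using g s by (simp add: commutator_inv_right inv_commutator)
        finally show ?thesis using g subgroup.m_inv_closed[OF U] by simp
      qed
    qed (use s T subgroup.m_closed[OF U] in \<open>auto simp: commutator_mult_left\<close>)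
    moreover have "derived_set G (carrier G) \<subseteq> {g \<in> carrier G. g \<diamondop> s \<in> U}"
    proof -
      have "(p \<diamondop> q) \<diamondop> s \<in> U" if "p \<in> carrier G" "q \<in> carrier G" for p q
        using subgroup.m_inv_closed[OF U T[OF s that]] s that by (simp add: inv_commutator)
      then show ?thesis by (auto simp flip: commutator_def)
    qed
    ultimately show ?thesis
      using generate_subgroup_incl g unfolding derived_def by blast
  qed
  define u v where "u = a \<diamondop> b" and "v = a \<diamondop> c"
  have uv: "u \<in> carrier G" "v \<in> carrier G" unfolding u_def v_def using abc by auto
  have "u [^] n \<in> U" "v [^] n \<in> U"
    unfolding u_def v_def using der pow abc by (simp_all flip: commutator_nat_pow)
  then obtain i j :: int where ij: "u [^] n = t [^] i" "v [^] n = t [^] j"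
    unfolding U_pow by blast
  have t3: "t [^] (3::nat) = \<one>" unfolding t_def using commutator_cubed abc by simp
  have "t = \<one>"
  proof (cases "u [^] n = \<one>")
    case True
    then have "c \<diamondop> u = \<one>" using central[OF uv(1) abc(3)] uv abc by (simp add: commutator_eq_one_iff)
    then show ?thesis using perm(2) unfolding u_def by simp
  next
    case False
    have ord3: "int (ord t) dvd 3" using t3 pow_eq_id[OF t] by (metis int_dvd_int_iff of_nat_numeral)
    then have "\<not> 3 dvd i" using False ij(1) int_pow_eq_id[OF t] dvd_trans by metis
    then have "i mod 3 = 1 \<or> i mod 3 = 2" by presburger
    then have "(i * i) mod 3 = 1" by (auto simp: mod_mult_eq[of i 3 i, symmetric])
    \<comment> \<open>\<open>i\<close> is its own inverse modulo 3\<close>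
    then have "3 dvd 1 - i * i" by presburger
    then have "3 dvd (1 - i * i) * j" by simp
    then have d3: "3 dvd j + i * - (i * j)" by (simp add: algebra_simps)
    \<comment> \<open>The exponent \<open>k = - (i * j)\<close> solves \<open>j + i * k = 0\<close>
      modulo 3, which makes the n-th power of \<open>v \<otimes> u'\<close> trivial.\<close>
    define u' where "u' = u [^] (- (i * j))"
    have u': "u' \<in> carrier G" unfolding u'_def using uv by simp
    \<comment> \<open>Needed to distribute the n-th power over \<open>v \<otimes> u'\<close>; [v,
      [a, b]] equals a fourfold commutator.\<close>
    have "v \<otimes> u = u \<otimes> v"
    proof -
      have "v \<diamondop> u = \<one>"
        using commutator_rotate[of "v" a b] commutator4_trivial[of a b a c] uv abc
        unfolding u_def v_def by simp
      then show ?thesis using uv by (simp add: commutator_eq_one_iff)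
    qed
    then have "u \<in> centralizer G {v}" using uv by (simp add: centralizer_def)
    then have "u' \<in> centralizer G {v}"
      unfolding u'_def using uv by (intro subgroup_int_pow_closed subgroup_centralizer) auto
    then have vu': "v \<otimes> u' = u' \<otimes> v" by (simp add: centralizer_def)
    have "(v \<otimes> u') [^] n = v [^] n \<otimes> u' [^] n"
      by (rule pow_mult_distrib[OF vu' uv(2) u'])
    also have "u' [^] n = (u [^] n) [^] (- (i * j))"
      unfolding u'_def using uv by (simp add: int_pow_pow mult.commute flip: int_pow_int)
    also have "v [^] n \<otimes> (u [^] n) [^] (- (i * j)) = t [^] (j + i * - (i * j))"
      unfolding ij using t by (simp only: int_pow_pow int_pow_mult)
    also have "\<dots> = \<one>" using d3 ord3 int_pow_eq_id[OF t] dvd_trans by blast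
    finally have "v \<otimes> u' \<in> centralizer G {b}"
      using central[of "v \<otimes> u'" b] abc uv u' by (simp add: centralizer_def)
    \<comment> \<open>Cancelling \<open>u'\<close> leaves \<open>v\<close> commuting with
      \<open>b\<close>, so [b, [a, c]], the inverse of \<open>t\<close>, is trivial.\<close>
    moreover have "u' \<in> centralizer G {b}"
    proof -
      have "b \<diamondop> u = \<one>" unfolding u_def using rep abc by simp
      then have "u \<in> centralizer G {b}" using abc uv by (simp add: centralizer_def commutator_eq_one_iff)
      then show ?thesis
        unfolding u'_def using abc by (intro subgroup_int_pow_closed subgroup_centralizer) auto
    qed
    ultimately have "(v \<otimes> u') \<otimes> inv u' \<in> centralizer G {b}"
      using abc(2) subgroup_centralizer[of "{b}"]
      by (simp add: subgroup.m_closed subgroup.m_inv_closed del: inv_mult_group)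
    then have "v \<in> centralizer G {b}" using uv u' by (simp add: m_assoc)
    then have "b \<diamondop> v = \<one>" using abc uv by (simp add: centralizer_def commutator_eq_one_iff)
    then have "inv t = \<one>" using perm(4) unfolding v_def by simp
    then show ?thesis using t by simp
  qed
  then have "U = {\<one>}" unfolding U_pow by auto
  then show ?thesis using T xyz by blast
qed

text \<open>All commutators are central, hence so is the derived subgroup. With terms counted from
  0, index 2 is the one that corresponds to class at most 2.\<close>

lemma lower_central_2_trivial:
  assumes triv: "\<And>x y z. \<lbrakk>x \<in> carrier G; y \<in> carrier G; z \<in> carrier G\<rbrakk> \<Longrightarrow> x \<diamondop> y \<diamondop> z = \<one>"
  shows "lower_central G 2 = {\<one>}"
proof -
  have "lower_central G 1 \<subseteq> centralizer G (carrier G)"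
    unfolding One_nat_def lower_central.simps
  proof (rule generate_subgroup_incl[OF _ subgroup_centralizer])
    have "(x \<diamondop> y) \<in> centralizer G (carrier G)" if "x \<in> carrier G" "y \<in> carrier G" for x y
      using triv[of _ x y] that by (simp add: centralizer_def commutator_eq_one_iff)
    then show "{x \<diamondop> y | x y. x \<in> carrier G \<and> y \<in> carrier G} \<subseteq> centralizer G (carrier G)" by blast
  qed simp
  then have "x \<diamondop> y = \<one>" if "x \<in> lower_central G 1" "y \<in> carrier G" for x y
    using that by (auto simp: centralizer_def commutator_eq_one_iff)
  then have "{x \<diamondop> y | x y. x \<in> lower_central G 1 \<and> y \<in> carrier G} \<subseteq> {\<one>}" by blast
  then have "lower_central G 2 \<subseteq> {\<one>}"
    unfolding numeral_2_eq_2 lower_central.simps(2)[of G "Suc 0"]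
    by (intro generate_subgroup_incl triv_subgroup) simp
  moreover have "\<one> \<in> lower_central G 2"
    unfolding numeral_2_eq_2 lower_central.simps(2)[of G "Suc 0"] by (rule generate.one)
  ultimately show ?thesis by blast
qed

end

subsection \<open>E-groups\<close>

text \<open>Conjugation by \<open>g\<close> is an endomorphism, and the E-property for it is
  \<open>conj_commute\<close>.\<close>

lemma E_group_imp_two_engel:
  assumes E: "E_group G"
  shows "two_engel G"
proof -
  interpret group G using E unfolding E_group_def by blast
  have "x \<otimes>\<^bsub>G\<^esub> (g \<otimes>\<^bsub>G\<^esub> x \<otimes>\<^bsub>G\<^esub> inv\<^bsub>G\<^esub> g) = (g \<otimes>\<^bsub>G\<^esub> x \<otimes>\<^bsub>G\<^esub> inv\<^bsub>G\<^esub> g) \<otimes>\<^bsub>G\<^esub> x"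
    if "x \<in> carrier G" "g \<in> carrier G" for x g
  proof -
    have "(\<lambda>x. g \<otimes>\<^bsub>G\<^esub> x \<otimes>\<^bsub>G\<^esub> inv\<^bsub>G\<^esub> g) \<in> hom G G"
      using that by (intro homI) (auto simp: m_assoc inv_cancel_left)
    from bspec[OF bspec[OF conjunct2[OF E[unfolded E_group_def]] this] that(1)]
    show ?thesis .
  qed
  then show ?thesis by unfold_locales auto
qed

text \<open>
  The elements mapped to \<open>y\<close> itself already generate \<open>G\<close>, and each of them commutes with \<open>y\<close>.
\<close>

lemma E_group_cyclic_image_central:
  fixes G (structure)
  assumes E: "E_group G" and f: "f \<in> hom G G" and a: "a \<in> carrier G" "f a = y"
    and cyc: "\<And>x. x \<in> carrier G \<Longrightarrow> \<exists>k::int. f x = y [^] k"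
    and g: "g \<in> carrier G"
  shows "g \<otimes> y = y \<otimes> g"
proof -
  interpret group G using E unfolding E_group_def by blast
  interpret f: group_hom G G f
    using f group_axioms by (simp add: group_hom_def group_hom_axioms_def)
  have comm: "x \<otimes> f x = f x \<otimes> x" if "x \<in> carrier G" for x
    using E f that unfolding E_group_def by blast
  have y: "y \<in> carrier G" using a by auto
  obtain k :: int where k: "f g = y [^] k" using cyc[OF g] by blast
  \<comment> \<open>The exponent \<open>1 - k\<close> is chosen so that \<open>f h = y\<close>; then
    \<open>y\<close> commutes with both \<open>h\<close> and \<open>a\<close>, hence with
    \<open>g\<close>.\<close>
  define h where "h = a [^] (1 - k) \<otimes> g"
  have h: "h \<in> carrier G" unfolding h_def using a g by simp
  have "f h = y [^] (1 - k) \<otimes> y [^] k"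
    unfolding h_def using a g k by (simp add: f.hom_int_pow)
  also have "\<dots> = y" using y by (simp flip: int_pow_mult)
  finally have hy: "h \<otimes> y = y \<otimes> h" using comm[OF h] by simp
  have ay: "a \<otimes> y = y \<otimes> a" using comm[OF a(1)] a(2) by simp
  define c where "c = a [^] (1 - k)"
  have c: "c \<in> carrier G" unfolding c_def using a by simp
  have cy: "c \<otimes> y = y \<otimes> c"
    using subgroup_int_pow_closed[OF subgroup_centralizer[of "{y}"], of a "1 - k"] a(1) y ay
    unfolding c_def by (auto simp: centralizer_def)
  have "c \<otimes> (g \<otimes> y) = c \<otimes> (y \<otimes> g)"
    using hy cy c g y unfolding h_def c_def[symmetric] by (simp add: m_assoc) (simp flip: m_assoc)
  then show ?thesis using c g y by simp
qed

theorem theorem1p1: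
  fixes G :: "('a, 'b) monoid_scheme"
  assumes "E_group G"
    and "finite (carrier G)"
    and "three_generator G"
  shows "nilpotent G \<and> nilpotency_class G \<le> 2"
proof -
  interpret two_engel G using assms(1) by (rule E_group_imp_two_engel)
  obtain n :: nat where n: "\<And>x. x \<in> carrier G \<Longrightarrow> x [^]\<^bsub>G\<^esub> n \<in> derived G (carrier G)"
    and ex: "\<And>y. \<lbrakk>y \<in> carrier G; y [^]\<^bsub>G\<^esub> n = \<one>\<^bsub>G\<^esub>\<rbrakk> \<Longrightarrow>
       \<exists>f \<in> hom G G. \<exists>a \<in> carrier G. f a = y \<and> (\<forall>x \<in> carrier G. \<exists>k::int. f x = y [^]\<^bsub>G\<^esub> k)"
    using abelianization_exponent_endo[OF assms(2)] by blast
  have central: "g \<otimes>\<^bsub>G\<^esub> y = y \<otimes>\<^bsub>G\<^esub> g"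
    if y: "y \<in> carrier G" "g \<in> carrier G" "y [^]\<^bsub>G\<^esub> n = \<one>\<^bsub>G\<^esub>" for y g
  proof -
    obtain f a where "f \<in> hom G G" "a \<in> carrier G" "f a = y"
      "\<And>x. x \<in> carrier G \<Longrightarrow> \<exists>k::int. f x = y [^]\<^bsub>G\<^esub> k"
      using ex[OF y(1,3)] by blast
    then show ?thesis using E_group_cyclic_image_central[OF assms(1) _ _ _ _ y(2)] by blast
  qed
  obtain a b c where "a \<in> carrier G" "b \<in> carrier G" "c \<in> carrier G" "generate G {a, b, c} = carrier G"
    using assms(3) unfolding three_generator_def by blast
  then have lc: "lower_central G 2 = {\<one>\<^bsub>G\<^esub>}"
    by (intro lower_central_2_trivial three_generator_class2[OF _ _ _ _ n central]) auto
  then show ?thesis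
    unfolding nilpotent_def nilpotency_class_def by (blast intro: Least_le)
qed

end
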